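(* Let $(\mathbf u_h^k,\mathbf B_h^k)_{k\ge0}$, together with the midpoint variables, be a solution of the fully discrete ideal Hall MHD scheme for the boundary condition $\mathbf u\cdot\mathbf n=0$ given in the context, with $\nabla\cdot\mathbf u_h^0=0$ and $\nabla\cdot\mathbf B_h^0=0$. For each $k$ let $\mathbf A_h^k\in\mathbf H^h_0(\mathrm{curl})$ satisfy $\nabla\times\mathbf A_h^k=\mathbf B_h^k$. Then for all $k\ge0$: $$\int_\Omega\mathbf u_h^{k+1}\cdot\mathbf u_h^{k+1}+S\,\mathbf B_h^{k+1}\cdot\mathbf B_h^{k+1}\,dx=\int_\Omega\mathbf u_h^k\cdot\mathbf u_h^k+S\,\mathbf B_h^k\cdot\mathbf B_h^k\,dx,$$ $$\int_\Omega\mathbf A_h^{k+1}\cdot\mathbf B_h^{k+1}\,dx=\int_\Omega\mathbf A_h^k\cdot\mathbf B_h^k\,dx,$$ $$\nabla\cdot\mathbf u_h^k=0,\qquad\nabla\cdot\mathbf B_h^k=0.$$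
   Context: $\Omega\subset\mathbb R^3$ is a bounded, simply connected Lipschitz polyhedron, $(\cdot,\cdot)$ the $L^2(\Omega)$ inner product, $S>0$ and $R_H\ge0$ constants, $\Delta t>0$ the time step. $H^h_0(\mathrm{grad})\subset H^1_0(\Omega)$, $\mathbf H^h_0(\mathrm{curl})\subset\mathbf H_0(\mathrm{curl},\Omega)$ (vanishing tangential trace), $\mathbf H^h_0(\mathrm{div})\subset\mathbf H_0(\mathrm{div},\Omega)$ (vanishing normal trace) and $L^2_h\subset L^2_0(\Omega)$ are conforming finite element spaces forming an exact discrete de Rham sequence $H^h_0(\mathrm{grad})\xrightarrow{\nabla}\mathbf H^h_0(\mathrm{curl})\xrightarrow{\nabla\times}\mathbf H^h_0(\mathrm{div})\xrightarrow{\nabla\cdot}L^2_h\to0$. Scheme ($\mathbf f=\mathbf 0$, formally $\mathrm{Re}^{-1}=\mathrm{Re_m}^{-1}=0$). Initial data $\mathbf u_h^0,\mathbf B_h^0\in\mathbf H^h_0(\mathrm{div})$ are given. Write $D_t\mathbf u_h=(\mathbf u_h^{k+1}-\mathbf u_h^k)/\Delta t$, $D_t\mathbf B_h=(\mathbf B_h^{k+1}-\mathbf B_h^k)/\Delta t$, $\mathbf u_h^{k+\frac12}=\frac12(\mathbf u_h^{k+1}+\mathbf u_h^k)$, $\mathbf B_h^{k+\frac12}=\frac12(\mathbf B_h^{k+1}+\mathbf B_h^k)$. For each $k\ge0$ find $\mathbf u_h^{k+1},\mathbf B_h^{k+1}\in\mathbf H^h_0(\mathrm{div})$ and midpoint variables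 (not averages) $p\in L^2_h$, $\mathbf E,\mathbf j,\mathbf H,\boldsymbol\omega,\mathbf U,\boldsymbol\alpha\in\mathbf H^h_0(\mathrm{curl})$ (at level $k+\frac12$) such that for all $q_h\in L^2_h$, $\mathbf v_h,\mathbf C_h\in\mathbf H^h_0(\mathrm{div})$ and $\mathbf F_h,\mathbf G_h,\boldsymbol\mu_h,\mathbf Z_h,\boldsymbol\beta_h,\mathbf k_h\in\mathbf H^h_0(\mathrm{curl})$ $$(D_t\mathbf u_h,\mathbf v_h)+(\boldsymbol\alpha,\mathbf v_h)+(\nabla\cdot\mathbf v_h,p)=0,\qquad(\nabla\cdot\mathbf u_h^{k+\frac12},q_h)=0,$$ $$(D_t\mathbf B_h,\mathbf C_h)+(\nabla\times\mathbf E,\mathbf C_h)=0,\qquad(\mathbf j,\mathbf F_h)-(\mathbf B_h^{k+\frac12},\nabla\times\mathbf F_h)=0,$$ $$(\mathbf H,\mathbf G_h)-(\mathbf B_h^{k+\frac12},\mathbf G_h)=0,\qquad(\boldsymbol\omega,\boldsymbol\mu_h)-(\mathbf u_h^{k+\frac12},\nabla\times\boldsymbol\mu_h)=0,$$ $$(\mathbf U,\mathbf Z_h)-(\mathbf u_h^{k+\frac12},\mathbf Z_h)=0,\qquad(\boldsymbol\alpha,\boldsymbol\beta_h)+(\boldsymbol\omega\times\mathbf U,\boldsymbol\beta_h)-S(\mathbf j\times\mathbf H,\boldsymbol\beta_h)=0\ \text{ (see the sign convention below)},$$ $$(\mathbf E,\mathbf k_h)-((R_H\mathbf j-\mathbf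 U)\times\mathbf H,\mathbf k_h)=0,$$ where the sign convention for $\boldsymbol\alpha$ is that $\boldsymbol\alpha$ equals the $L^2$-projection onto $\mathbf H^h_0(\mathrm{curl})$ of $\boldsymbol\omega\times\mathbf U-S\,\mathbf j\times\mathbf H$, i.e. the equation for $\boldsymbol\alpha$ is to be read as $(\boldsymbol\alpha,\boldsymbol\beta_h)-(\boldsymbol\omega\times\mathbf U,\boldsymbol\beta_h)+S(\mathbf j\times\mathbf H,\boldsymbol\beta_h)=0$ for all $\boldsymbol\beta_h\in\mathbf H^h_0(\mathrm{curl})$. *)

theory Defs
  imports "HOL-Analysis.Analysis"
begin

type_synonym r3 = "real^3"

text \<open>Near every boundary point, \<open>\<Omega>\<close> is the strict subgraph, in the direction of a unit
  vector \<open>e\<close>, of a Lipschitz function of the coordinates orthogonal to \<open>e\<close>.\<close>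

definition lipschitz_boundary :: "r3 set \<Rightarrow> bool" where
  "lipschitz_boundary \<Omega> \<longleftrightarrow>
     (\<forall>x0\<in>frontier \<Omega>. \<exists>e r L. \<exists>g :: r3 \<Rightarrow> real.
        norm e = 1 \<and> r > 0 \<and> L-lipschitz_on {y. y \<bullet> e = 0} g \<and>
        (\<forall>x\<in>ball x0 r. x \<in> \<Omega> \<longleftrightarrow> x \<bullet> e < g (x - (x \<bullet> e) *\<^sub>R e)))"

text \<open>The library's \<open>polyhedron\<close> is convex; a polyhedral domain need not be, so it is
  described by a decomposition of its closure into finitely many convex polytopes.\<close>

definition lipschitz_polyhedron :: "r3 set \<Rightarrow> bool" where
  "lipschitz_polyhedron \<Omega> \<longleftrightarrow>
     open \<Omega> \<and> connected \<Omega> \<and> \<Omega> \<noteq> {} \<and> bounded \<Omega> \<and>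
     (\<exists>T. finite T \<and> (\<forall>P\<in>T. polytope P) \<and> closure \<Omega> = \<Union>T) \<and>
     lipschitz_boundary \<Omega>"

text \<open>Elements of \<open>L\<^sup>2(\<Omega>)\<close> are represented by functions on the whole space whose values
  outside \<open>\<Omega>\<close> are irrelevant; equality in \<open>L\<^sup>2(\<Omega>)\<close> is \<open>ae_eq \<Omega>\<close>.\<close>

definition ae_eq :: "r3 set \<Rightarrow> (r3 \<Rightarrow> 'b) \<Rightarrow> (r3 \<Rightarrow> 'b) \<Rightarrow> bool" where
  "ae_eq \<Omega> f g \<longleftrightarrow> (AE x in lebesgue_on \<Omega>. f x = g x)"

definition L2 :: "r3 set \<Rightarrow> (r3 \<Rightarrow> 'b::euclidean_space) set" where
  "L2 \<Omega> = {f. f \<in> borel_measurable (lebesgue_on \<Omega>) \<and>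
               integrable (lebesgue_on \<Omega>) (\<lambda>x. (norm (f x))\<^sup>2)}"

definition L2_inner :: "r3 set \<Rightarrow> (r3 \<Rightarrow> 'b::euclidean_space) \<Rightarrow> (r3 \<Rightarrow> 'b) \<Rightarrow> real" where
  "L2_inner \<Omega> f g = (LINT x|lebesgue_on \<Omega>. f x \<bullet> g x)"

definition L2_norm :: "r3 set \<Rightarrow> (r3 \<Rightarrow> 'b::euclidean_space) \<Rightarrow> real" where
  "L2_norm \<Omega> f = sqrt (L2_inner \<Omega> f f)"

definition L2_0 :: "r3 set \<Rightarrow> (r3 \<Rightarrow> real) set" where
  "L2_0 \<Omega> = {q \<in> L2 \<Omega>. (LINT x|lebesgue_on \<Omega>. q x) = 0}"

definition L2_tendsto ::
  "r3 set \<Rightarrow> (nat \<Rightarrow> r3 \<Rightarrow> 'b::euclidean_space) \<Rightarrow> (r3 \<Rightarrow> 'b) \<Rightarrow> bool" where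
  "L2_tendsto \<Omega> f g \<longleftrightarrow> (\<lambda>n. L2_norm \<Omega> (\<lambda>x. f n x - g x)) \<longlonglongrightarrow> 0"

definition pd :: "3 \<Rightarrow> (r3 \<Rightarrow> 'b::real_normed_vector) \<Rightarrow> r3 \<Rightarrow> 'b" where
  "pd i f x = frechet_derivative f (at x) (axis i 1)"

primrec Ck :: "nat \<Rightarrow> (r3 \<Rightarrow> 'b::real_normed_vector) \<Rightarrow> bool" where
  "Ck 0 f \<longleftrightarrow> continuous_on UNIV f"
| "Ck (Suc n) f \<longleftrightarrow> (\<forall>x. f differentiable at x) \<and> (\<forall>i. Ck n (pd i f))"

definition test_functions :: "r3 set \<Rightarrow> (r3 \<Rightarrow> 'b::real_normed_vector) set" where
  "test_functions \<Omega> =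
     {\<phi>. (\<forall>n. Ck n \<phi>) \<and> (\<exists>K. compact K \<and> K \<subseteq> \<Omega> \<and> (\<forall>x. x \<notin> K \<longrightarrow> \<phi> x = 0))}"

definition grad :: "(r3 \<Rightarrow> real) \<Rightarrow> r3 \<Rightarrow> r3" where
  "grad \<phi> x = (\<chi> i. pd i \<phi> x)"

definition curl :: "(r3 \<Rightarrow> r3) \<Rightarrow> r3 \<Rightarrow> r3" where
  "curl \<phi> x = vector [pd 2 \<phi> x $ 3 - pd 3 \<phi> x $ 2,
                      pd 3 \<phi> x $ 1 - pd 1 \<phi> x $ 3,
                      pd 1 \<phi> x $ 2 - pd 2 \<phi> x $ 1]"

definition dvg :: "(r3 \<Rightarrow> r3) \<Rightarrow> r3 \<Rightarrow> real" where
  "dvg \<phi> x = (\<Sum>i\<in>UNIV. pd i \<phi> x $ i)"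

definition has_weak_grad :: "r3 set \<Rightarrow> (r3 \<Rightarrow> real) \<Rightarrow> (r3 \<Rightarrow> r3) \<Rightarrow> bool" where
  "has_weak_grad \<Omega> u w \<longleftrightarrow> u \<in> L2 \<Omega> \<and> w \<in> L2 \<Omega> \<and>
     (\<forall>\<psi>\<in>test_functions \<Omega>. L2_inner \<Omega> w \<psi> = - L2_inner \<Omega> u (dvg \<psi>))"

definition has_weak_curl :: "r3 set \<Rightarrow> (r3 \<Rightarrow> r3) \<Rightarrow> (r3 \<Rightarrow> r3) \<Rightarrow> bool" where
  "has_weak_curl \<Omega> u w \<longleftrightarrow> u \<in> L2 \<Omega> \<and> w \<in> L2 \<Omega> \<and>
     (\<forall>\<psi>\<in>test_functions \<Omega>. L2_inner \<Omega> w \<psi> = L2_inner \<Omega> u (curl \<psi>))"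

definition has_weak_div :: "r3 set \<Rightarrow> (r3 \<Rightarrow> r3) \<Rightarrow> (r3 \<Rightarrow> real) \<Rightarrow> bool" where
  "has_weak_div \<Omega> u w \<longleftrightarrow> u \<in> L2 \<Omega> \<and> w \<in> L2 \<Omega> \<and>
     (\<forall>\<psi>\<in>test_functions \<Omega>. L2_inner \<Omega> w \<psi> = - L2_inner \<Omega> u (grad \<psi>))"

text \<open>Weak derivatives are unique up to null sets; the operators below pick a representative
  and are meaningful only on functions for which a weak derivative exists.\<close>

definition weak_grad :: "r3 set \<Rightarrow> (r3 \<Rightarrow> real) \<Rightarrow> r3 \<Rightarrow> r3" where
  "weak_grad \<Omega> u = (SOME w. has_weak_grad \<Omega> u w)"

definition weak_curl :: "r3 set \<Rightarrow> (r3 \<Rightarrow> r3) \<Rightarrow> r3 \<Rightarrow> r3" where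
  "weak_curl \<Omega> u = (SOME w. has_weak_curl \<Omega> u w)"

definition weak_div :: "r3 set \<Rightarrow> (r3 \<Rightarrow> r3) \<Rightarrow> r3 \<Rightarrow> real" where
  "weak_div \<Omega> u = (SOME w. has_weak_div \<Omega> u w)"

text \<open>The usual definition of these spaces as closures of the test functions in the graph norm;
  on a Lipschitz domain they are the kernels of the trace, the tangential trace and the
  normal trace.\<close>

definition H0_grad :: "r3 set \<Rightarrow> (r3 \<Rightarrow> real) set" where
  "H0_grad \<Omega> = {u. (\<exists>w. has_weak_grad \<Omega> u w) \<and>
     (\<exists>\<phi>. (\<forall>n. \<phi> n \<in> test_functions \<Omega>) \<and> L2_tendsto \<Omega> \<phi> u \<and>
          L2_tendsto \<Omega> (\<lambda>n. grad (\<phi> n)) (weak_grad \<Omega> u))}"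

definition H0_curl :: "r3 set \<Rightarrow> (r3 \<Rightarrow> r3) set" where
  "H0_curl \<Omega> = {u. (\<exists>w. has_weak_curl \<Omega> u w) \<and>
     (\<exists>\<phi>. (\<forall>n. \<phi> n \<in> test_functions \<Omega>) \<and> L2_tendsto \<Omega> \<phi> u \<and>
          L2_tendsto \<Omega> (\<lambda>n. curl (\<phi> n)) (weak_curl \<Omega> u))}"

definition H0_div :: "r3 set \<Rightarrow> (r3 \<Rightarrow> r3) set" where
  "H0_div \<Omega> = {u. (\<exists>w. has_weak_div \<Omega> u w) \<and>
     (\<exists>\<phi>. (\<forall>n. \<phi> n \<in> test_functions \<Omega>) \<and> L2_tendsto \<Omega> \<phi> u \<and>
          L2_tendsto \<Omega> (\<lambda>n. dvg (\<phi> n)) (weak_div \<Omega> u))}"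

text \<open>A finite-dimensional space of bounded functions, closed under almost-everywhere
  equality. Boundedness makes the trilinear forms of the scheme well-defined.\<close>

definition fe_space :: "r3 set \<Rightarrow> (r3 \<Rightarrow> 'b::euclidean_space) set \<Rightarrow> bool" where
  "fe_space \<Omega> V \<longleftrightarrow>
     (\<exists>b. finite b \<and>
        (\<forall>f\<in>b. f \<in> borel_measurable (lebesgue_on \<Omega>) \<and>
               (\<exists>M. AE x in lebesgue_on \<Omega>. norm (f x) \<le> M)) \<and>
        V = {v. \<exists>c. ae_eq \<Omega> v (\<lambda>x. \<Sum>f\<in>b. c f *\<^sub>R f x)})"

definition discrete_de_Rham ::
  "r3 set \<Rightarrow> (r3 \<Rightarrow> real) set \<Rightarrow> (r3 \<Rightarrow> r3) set \<Rightarrow> (r3 \<Rightarrow> r3) set \<Rightarrow> (r3 \<Rightarrow> real) set \<Rightarrow> bool" where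
  "discrete_de_Rham \<Omega> Vgrad Vcurl Vdiv Q \<longleftrightarrow>
     fe_space \<Omega> Vgrad \<and> Vgrad \<subseteq> H0_grad \<Omega> \<and>
     fe_space \<Omega> Vcurl \<and> Vcurl \<subseteq> H0_curl \<Omega> \<and>
     fe_space \<Omega> Vdiv \<and> Vdiv \<subseteq> H0_div \<Omega> \<and>
     fe_space \<Omega> Q \<and> Q \<subseteq> L2_0 \<Omega> \<and>
     {v \<in> Vcurl. has_weak_curl \<Omega> v (\<lambda>_. 0)} = {v. \<exists>\<phi>\<in>Vgrad. has_weak_grad \<Omega> \<phi> v} \<and>
     {w \<in> Vdiv. has_weak_div \<Omega> w (\<lambda>_. 0)} = {w. \<exists>v\<in>Vcurl. has_weak_curl \<Omega> v w} \<and>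
     Q = {q. \<exists>w\<in>Vdiv. has_weak_div \<Omega> w q}"

definition diff_quot :: "real \<Rightarrow> (nat \<Rightarrow> r3 \<Rightarrow> r3) \<Rightarrow> nat \<Rightarrow> r3 \<Rightarrow> r3" where
  "diff_quot \<Delta>t u k x = (u (Suc k) x - u k x) /\<^sub>R \<Delta>t"

definition midpt :: "(nat \<Rightarrow> r3 \<Rightarrow> r3) \<Rightarrow> nat \<Rightarrow> r3 \<Rightarrow> r3" where
  "midpt u k x = (1/2) *\<^sub>R (u (Suc k) x + u k x)"

text \<open>In \<open>E k\<close>, \<open>j k\<close>, etc. the index \<open>k\<close> stands for the time level \<open>k + 1/2\<close>.\<close>

definition ideal_hall_mhd_scheme ::
  "r3 set \<Rightarrow> (r3 \<Rightarrow> r3) set \<Rightarrow> (r3 \<Rightarrow> r3) set \<Rightarrow> (r3 \<Rightarrow> real) set \<Rightarrow> real \<Rightarrow> real \<Rightarrow> real \<Rightarrow>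
   (nat \<Rightarrow> r3 \<Rightarrow> r3) \<Rightarrow> (nat \<Rightarrow> r3 \<Rightarrow> r3) \<Rightarrow> (nat \<Rightarrow> r3 \<Rightarrow> real) \<Rightarrow>
   (nat \<Rightarrow> r3 \<Rightarrow> r3) \<Rightarrow> (nat \<Rightarrow> r3 \<Rightarrow> r3) \<Rightarrow> (nat \<Rightarrow> r3 \<Rightarrow> r3) \<Rightarrow>
   (nat \<Rightarrow> r3 \<Rightarrow> r3) \<Rightarrow> (nat \<Rightarrow> r3 \<Rightarrow> r3) \<Rightarrow> (nat \<Rightarrow> r3 \<Rightarrow> r3) \<Rightarrow> bool" where
  "ideal_hall_mhd_scheme \<Omega> Vcurl Vdiv Q S RH \<Delta>t u B p E j H \<omega> U \<alpha> \<longleftrightarrow>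
     (\<forall>k. u k \<in> Vdiv \<and> B k \<in> Vdiv \<and> p k \<in> Q \<and>
          E k \<in> Vcurl \<and> j k \<in> Vcurl \<and> H k \<in> Vcurl \<and>
          \<omega> k \<in> Vcurl \<and> U k \<in> Vcurl \<and> \<alpha> k \<in> Vcurl) \<and>
     (\<forall>k. (\<forall>v\<in>Vdiv. L2_inner \<Omega> (diff_quot \<Delta>t u k) v + L2_inner \<Omega> (\<alpha> k) v
                      + L2_inner \<Omega> (weak_div \<Omega> v) (p k) = 0) \<and>
          (\<forall>q\<in>Q. L2_inner \<Omega> (weak_div \<Omega> (midpt u k)) q = 0) \<and>
          (\<forall>C\<in>Vdiv. L2_inner \<Omega> (diff_quot \<Delta>t B k) C + L2_inner \<Omega> (weak_curl \<Omega> (E k)) C = 0) \<and>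
          (\<forall>F\<in>Vcurl. L2_inner \<Omega> (j k) F - L2_inner \<Omega> (midpt B k) (weak_curl \<Omega> F) = 0) \<and>
          (\<forall>G\<in>Vcurl. L2_inner \<Omega> (H k) G - L2_inner \<Omega> (midpt B k) G = 0) \<and>
          (\<forall>\<mu>\<in>Vcurl. L2_inner \<Omega> (\<omega> k) \<mu> - L2_inner \<Omega> (midpt u k) (weak_curl \<Omega> \<mu>) = 0) \<and>
          (\<forall>Z\<in>Vcurl. L2_inner \<Omega> (U k) Z - L2_inner \<Omega> (midpt u k) Z = 0) \<and>
          (\<forall>\<beta>\<in>Vcurl. L2_inner \<Omega> (\<alpha> k) \<beta> - L2_inner \<Omega> (\<lambda>x. cross3 (\<omega> k x) (U k x)) \<beta>
                      + S * L2_inner \<Omega> (\<lambda>x. cross3 (j k x) (H k x)) \<beta> = 0) \<and>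
          (\<forall>\<kappa>\<in>Vcurl. L2_inner \<Omega> (E k) \<kappa>
                      - L2_inner \<Omega> (\<lambda>x. cross3 (RH *\<^sub>R j k x - U k x) (H k x)) \<kappa> = 0))"

end

theory Submission
  imports Defs
begin

text \<open>The scheme is arranged so that every identity follows by choosing test functions inside the
  discrete spaces.

  \<^bold>\<open>Energy.\<close> Test the momentum equation with the midpoint velocity and Faraday's law with the
  midpoint magnetic field. The pressure drops out because the pressure is itself an admissible test
  function of the incompressibility equation. The projections \<open>U\<close>, \<open>\<alpha>\<close> and the weak form of \<open>j\<close>
  exchange each remaining quantity for one in the curl space, after which \<open>(\<omega> \<times> U) \<bullet> U = 0\<close>
  pointwise and the work of the Lorentz force \<open>(j \<times> H, U)\<close> appears once with factor \<open>S\<close> in the kinetic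
  balance and once with factor \<open>-1\<close> in the magnetic balance (\<open>Lorentz_work_cancels\<close>).

  \<^bold>\<open>Divergence.\<close> The divergence of the midpoint velocity lies in \<open>Q\<close>, so it may be tested against
  itself and vanishes; induction on the time level then gives the velocity. Since the curl maps the
  curl space into \<open>Vdiv\<close>, Faraday's law holds not just weakly but almost everywhere (\<open>faraday_AE\<close>),
  so the magnetic field changes only by a curl, which is divergence free by exactness of the complex.

  \<^bold>\<open>Helicity.\<close> The curl is symmetric on fields with vanishing tangential trace
  (\<open>weak_curl_symmetric\<close>, by approximation with test functions). Hence \<open>(A', B) = (A, B')\<close> for the
  potentials and fields at two time levels, and the change of helicity over a step is
  \<open>(A' + A, B' - B) = - dt (A' + A, curl E) = - dt (B' + B, E)\<close>. The midpoint of \<open>B\<close> and its projection \<open>H\<close>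
  agree when tested with \<open>E\<close>, and testing Ohm's law with \<open>H\<close> gives \<open>(E, H) = 0\<close>, since \<open>E\<close> is the
  projection of a cross product with \<open>H\<close>.\<close>

section \<open>The space \<open>L2\<close> and its bilinear form\<close>

lemma L2_measurable: "f \<in> L2 \<Omega> \<Longrightarrow> f \<in> borel_measurable (lebesgue_on \<Omega>)"
  by (simp add: L2_def)

lemma integrable_L2_inner:
  assumes "f \<in> L2 \<Omega>" "g \<in> L2 \<Omega>"
  shows "integrable (lebesgue_on \<Omega>) (\<lambda>x. f x \<bullet> g x)"
proof (rule Bochner_Integration.integrable_bound)
  show "integrable (lebesgue_on \<Omega>) (\<lambda>x. (norm (f x))\<^sup>2 + (norm (g x))\<^sup>2)"
    using assms by (simp add: L2_def)
  show "(\<lambda>x. f x \<bullet> g x) \<in> borel_measurable (lebesgue_on \<Omega>)"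
    using assms by (intro borel_measurable_inner L2_measurable)
  have "\<bar>a \<bullet> b\<bar> \<le> \<bar>(norm a)\<^sup>2 + (norm b)\<^sup>2\<bar>" for a b :: 'a
  proof -
    have "\<bar>a \<bullet> b\<bar> \<le> norm a * norm b" by (rule Cauchy_Schwarz_ineq2)
    also have "\<dots> \<le> (norm a)\<^sup>2 + (norm b)\<^sup>2"
      using sum_squares_bound[of "norm a" "norm b"]
        mult_nonneg_nonneg[OF norm_ge_zero[of a] norm_ge_zero[of b]] by linarith
    finally show ?thesis by simp
  qed
  then show "AE x in lebesgue_on \<Omega>. norm (f x \<bullet> g x) \<le> norm ((norm (f x))\<^sup>2 + (norm (g x))\<^sup>2)"
    by simp
qed

lemma L2_scaleR: "f \<in> L2 \<Omega> \<Longrightarrow> (\<lambda>x. c *\<^sub>R f x) \<in> L2 \<Omega>"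
  by (auto simp: L2_def power_mult_distrib)

lemma L2_add:
  assumes "f \<in> L2 \<Omega>" "g \<in> L2 \<Omega>"
  shows "(\<lambda>x. f x + g x) \<in> L2 \<Omega>"
proof -
  have "integrable (lebesgue_on \<Omega>) (\<lambda>x. f x \<bullet> f x + 2 * (f x \<bullet> g x) + g x \<bullet> g x)"
    using assms by (intro Bochner_Integration.integrable_add integrable_mult_right integrable_L2_inner)
  moreover have "(norm (f x + g x))\<^sup>2 = f x \<bullet> f x + 2 * (f x \<bullet> g x) + g x \<bullet> g x" for x
    by (simp add: power2_norm_eq_inner inner_add inner_commute)
  ultimately show ?thesis
    using assms by (simp add: L2_def borel_measurable_add)
qed

lemma L2_diff:
  assumes "f \<in> L2 \<Omega>" "g \<in> L2 \<Omega>"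
  shows "(\<lambda>x. f x - g x) \<in> L2 \<Omega>"
  using L2_add[OF assms(1) L2_scaleR[OF assms(2), of "-1"]] by simp

lemma L2_zero: "(\<lambda>_. 0) \<in> L2 \<Omega>"
  by (simp add: L2_def)

lemma L2_inner_commute: "L2_inner \<Omega> f g = L2_inner \<Omega> g f"
  by (simp add: L2_inner_def inner_commute)

lemma L2_inner_add_left:
  assumes "f \<in> L2 \<Omega>" "g \<in> L2 \<Omega>" "h \<in> L2 \<Omega>"
  shows "L2_inner \<Omega> (\<lambda>x. f x + g x) h = L2_inner \<Omega> f h + L2_inner \<Omega> g h"
  by (simp add: L2_inner_def inner_add_left integrable_L2_inner assms)

lemma L2_inner_diff_left:
  assumes "f \<in> L2 \<Omega>" "g \<in> L2 \<Omega>" "h \<in> L2 \<Omega>"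
  shows "L2_inner \<Omega> (\<lambda>x. f x - g x) h = L2_inner \<Omega> f h - L2_inner \<Omega> g h"
  by (simp add: L2_inner_def inner_diff_left integrable_L2_inner assms)

lemma L2_inner_scaleR_left: "L2_inner \<Omega> (\<lambda>x. c *\<^sub>R f x) h = c * L2_inner \<Omega> f h"
  by (simp add: L2_inner_def)

lemma L2_inner_zero_left: "L2_inner \<Omega> (\<lambda>_. 0) h = 0"
  by (simp add: L2_inner_def)

lemma L2_inner_cong_AE:
  assumes "ae_eq \<Omega> f g" "f \<in> L2 \<Omega>" "g \<in> L2 \<Omega>" "h \<in> L2 \<Omega>"
  shows "L2_inner \<Omega> f h = L2_inner \<Omega> g h"
  unfolding L2_inner_def
proof (rule integral_cong_AE)
  show "AE x in lebesgue_on \<Omega>. f x \<bullet> h x = g x \<bullet> h x"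
    using assms(1) unfolding ae_eq_def by eventually_elim simp
  show "(\<lambda>x. f x \<bullet> h x) \<in> borel_measurable (lebesgue_on \<Omega>)"
       "(\<lambda>x. g x \<bullet> h x) \<in> borel_measurable (lebesgue_on \<Omega>)"
    using assms(2-4) by (auto simp: L2_def)
qed

lemma L2_inner_self_nonneg: "0 \<le> L2_inner \<Omega> f f"
  by (simp add: L2_inner_def)

lemma L2_inner_self_eq_zero_imp:
  assumes "f \<in> L2 \<Omega>" "L2_inner \<Omega> f f = 0"
  shows "ae_eq \<Omega> f (\<lambda>_. 0)"
  using integral_nonneg_eq_0_iff_AE[OF integrable_L2_inner[OF assms(1) assms(1)]] assms(2)
  by (simp add: ae_eq_def L2_inner_def)

lemma L2_Cauchy_Schwarz:
  assumes "f \<in> L2 \<Omega>" "g \<in> L2 \<Omega>"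
  shows "\<bar>L2_inner \<Omega> f g\<bar> \<le> L2_norm \<Omega> f * L2_norm \<Omega> g"
proof -
  have one_sided: "L2_inner \<Omega> f g \<le> L2_norm \<Omega> f * L2_norm \<Omega> g"
    if f: "f \<in> L2 \<Omega>" and g: "g \<in> L2 \<Omega>" for f g :: "r3 \<Rightarrow> 'a"
  proof (cases "L2_inner \<Omega> f f = 0 \<or> L2_inner \<Omega> g g = 0")
    case True
    then have "L2_inner \<Omega> f g = 0"
    proof
      assume "L2_inner \<Omega> f f = 0"
      then show ?thesis
        using L2_inner_cong_AE[OF L2_inner_self_eq_zero_imp f L2_zero g] f by (simp add: L2_inner_zero_left)
    next
      assume "L2_inner \<Omega> g g = 0"
      then show ?thesis
        using L2_inner_cong_AE[OF L2_inner_self_eq_zero_imp g L2_zero f] g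
        by (simp add: L2_inner_zero_left L2_inner_commute[of \<Omega> f g])
    qed
    then show ?thesis by (simp add: L2_norm_def L2_inner_self_nonneg)
  next
    case False
    \<comment> \<open>Expand the square of the norm of \<open>b f - a g\<close>: the weights make both square terms equal to
      \<open>a\<^sup>2 b\<^sup>2\<close>.\<close>
    define a b where "a = L2_norm \<Omega> f" and "b = L2_norm \<Omega> g"
    have pos: "a > 0" "b > 0"
      using False L2_inner_self_nonneg[of \<Omega> f] L2_inner_self_nonneg[of \<Omega> g]
      by (auto simp: a_def b_def L2_norm_def less_le)
    have sq: "a\<^sup>2 = L2_inner \<Omega> f f" "b\<^sup>2 = L2_inner \<Omega> g g"
      by (simp_all add: a_def b_def L2_norm_def L2_inner_self_nonneg)
    let ?d = "\<lambda>x. b *\<^sub>R f x - a *\<^sub>R g x"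
    have d: "?d \<in> L2 \<Omega>" by (intro L2_diff L2_scaleR f g)
    have "L2_inner \<Omega> ?d h = b * L2_inner \<Omega> h f - a * L2_inner \<Omega> h g" if "h \<in> L2 \<Omega>" for h
      using that f g
      by (simp add: L2_inner_diff_left L2_scaleR L2_inner_scaleR_left
            L2_inner_commute[of \<Omega> h f] L2_inner_commute[of \<Omega> h g])
    from this[OF d] this[OF f] this[OF g]
    have "L2_inner \<Omega> ?d ?d = b * (b * a\<^sup>2 - a * L2_inner \<Omega> f g) - a * (b * L2_inner \<Omega> f g - a * b\<^sup>2)"
      by (simp add: sq L2_inner_commute[of \<Omega> g f])
    also have "\<dots> = 2 * (a * b) * (a * b - L2_inner \<Omega> f g)"
      by (simp add: power2_eq_square algebra_simps)
    finally have "L2_inner \<Omega> ?d ?d = 2 * (a * b) * (a * b - L2_inner \<Omega> f g)" .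
    with L2_inner_self_nonneg[of \<Omega> ?d] mult_pos_pos[OF pos] show ?thesis
      by (simp add: a_def[symmetric] b_def[symmetric] zero_le_mult_iff)
  qed
  have "- L2_inner \<Omega> f g = L2_inner \<Omega> (\<lambda>x. (-1) *\<^sub>R f x) g"
    by (subst L2_inner_scaleR_left) simp
  also have "\<dots> \<le> L2_norm \<Omega> (\<lambda>x. (-1) *\<^sub>R f x) * L2_norm \<Omega> g"
    by (intro one_sided L2_scaleR assms)
  also have "L2_norm \<Omega> (\<lambda>x. (-1) *\<^sub>R f x) = L2_norm \<Omega> f"
    by (simp add: L2_norm_def L2_inner_def)
  finally show ?thesis using one_sided[OF assms] by simp
qed

lemma L2_inner_tendsto_left:
  assumes "L2_tendsto \<Omega> f g" "\<And>n. f n \<in> L2 \<Omega>" "g \<in> L2 \<Omega>" "h \<in> L2 \<Omega>"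
  shows "(\<lambda>n. L2_inner \<Omega> (f n) h) \<longlonglongrightarrow> L2_inner \<Omega> g h"
proof -
  have "(\<lambda>n. L2_inner \<Omega> (f n) h - L2_inner \<Omega> g h) \<longlonglongrightarrow> 0"
  proof (rule Lim_null_comparison)
    have "\<bar>L2_inner \<Omega> (f n) h - L2_inner \<Omega> g h\<bar> \<le> L2_norm \<Omega> (\<lambda>x. f n x - g x) * L2_norm \<Omega> h" for n
      using L2_Cauchy_Schwarz[OF L2_diff[OF assms(2)[of n] assms(3)] assms(4)] assms
      by (simp add: L2_inner_diff_left)
    then show "\<forall>\<^sub>F n in sequentially. norm (L2_inner \<Omega> (f n) h - L2_inner \<Omega> g h)
                 \<le> L2_norm \<Omega> (\<lambda>x. f n x - g x) * L2_norm \<Omega> h" by simp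
    show "(\<lambda>n. L2_norm \<Omega> (\<lambda>x. f n x - g x) * L2_norm \<Omega> h) \<longlonglongrightarrow> 0"
      using assms(1) by (auto simp: L2_tendsto_def intro: tendsto_mult_left_zero)
  qed
  then show ?thesis by (simp add: LIM_zero_iff)
qed

text \<open>Test functions and their derivatives are square integrable because they are continuous on the
  whole space, hence bounded on the compact closure of \<open>\<Omega>\<close>.\<close>

lemma continuous_imp_L2:
  fixes f :: "r3 \<Rightarrow> 'b::euclidean_space"
  assumes "open \<Omega>" "bounded \<Omega>" "continuous_on UNIV f"
  shows "f \<in> L2 \<Omega>"
proof -
  have cl: "compact (closure \<Omega>)" using assms(2) by (simp add: compact_closure)
  have meas: "\<Omega> \<in> lmeasurable" using assms by (simp add: lmeasurable_open)
  have fm: "f \<in> borel_measurable (lebesgue_on \<Omega>)"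
    using assms by (intro continuous_imp_measurable_on_sets_lebesgue continuous_on_subset[OF assms(3)]) auto
  have "bounded ((\<lambda>x. (norm (f x))\<^sup>2) ` closure \<Omega>)"
    by (intro compact_imp_bounded compact_continuous_image cl continuous_intros
        continuous_on_subset[OF assms(3)]) auto
  then obtain c where c: "\<And>x. x \<in> closure \<Omega> \<Longrightarrow> norm ((norm (f x))\<^sup>2) \<le> c"
    by (auto simp: bounded_iff)
  have "integrable (lebesgue_on \<Omega>) (\<lambda>x. (norm (f x))\<^sup>2)"
  proof (rule Bochner_Integration.integrable_bound)
    show "integrable (lebesgue_on \<Omega>) (\<lambda>x. c)"
      by (rule finite_measure.integrable_const[OF finite_measure_lebesgue_on[OF meas]])
    show "AE x in lebesgue_on \<Omega>. norm ((norm (f x))\<^sup>2) \<le> norm c"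
      using c closure_subset[of \<Omega>] by (intro AE_I2) (fastforce simp: space_restrict_space)
  qed (use fm in measurable)
  with fm show ?thesis by (simp add: L2_def)
qed

lemma test_function_continuous:
  "\<phi> \<in> test_functions \<Omega> \<Longrightarrow> continuous_on UNIV \<phi>"
  unfolding test_functions_def by (metis (mono_tags, lifting) Ck.simps(1) mem_Collect_eq)

lemma test_function_pd_continuous:
  "\<phi> \<in> test_functions \<Omega> \<Longrightarrow> continuous_on UNIV (pd i \<phi>)"
  unfolding test_functions_def by (metis (mono_tags, lifting) Ck.simps mem_Collect_eq)

lemma curl_test_function_continuous:
  assumes "\<phi> \<in> test_functions \<Omega>"
  shows "continuous_on UNIV (curl \<phi>)"
proof -
  note c = test_function_pd_continuous[OF assms]
  have "\<forall>i. continuous_on UNIV (\<lambda>x. curl \<phi> x $ i)"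
    by (simp add: forall_3 curl_def continuous_on_diff continuous_on_component c)
  then have "continuous_on UNIV (\<lambda>x. \<chi> i. curl \<phi> x $ i)"
    by (intro continuous_on_vec_lambda) blast
  then show ?thesis by simp
qed

lemma grad_test_function_continuous:
  assumes "\<phi> \<in> test_functions \<Omega>"
  shows "continuous_on UNIV (grad \<phi>)"
  unfolding grad_def by (intro continuous_on_vec_lambda test_function_pd_continuous[OF assms])

section \<open>Weak derivatives\<close>

lemma H0_curl_weak_curl: "u \<in> H0_curl \<Omega> \<Longrightarrow> has_weak_curl \<Omega> u (weak_curl \<Omega> u)"
  using someI_ex[of "has_weak_curl \<Omega> u"] by (simp add: H0_curl_def weak_curl_def)

lemma H0_div_weak_div: "u \<in> H0_div \<Omega> \<Longrightarrow> has_weak_div \<Omega> u (weak_div \<Omega> u)"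
  using someI_ex[of "has_weak_div \<Omega> u"] by (simp add: H0_div_def weak_div_def)

text \<open>Integration by parts without a boundary term. For a test function in place of \<open>u\<close> this is the
  definition of the weak curl of \<open>v\<close>; membership in \<open>H0_curl\<close> says precisely that \<open>u\<close> and its curl
  are simultaneous limits of such functions.\<close>

lemma weak_curl_symmetric:
  assumes "open \<Omega>" "bounded \<Omega>" "u \<in> H0_curl \<Omega>" "has_weak_curl \<Omega> v w"
  shows "L2_inner \<Omega> (weak_curl \<Omega> u) v = L2_inner \<Omega> u w"
proof -
  obtain \<phi> where \<phi>: "\<And>n. \<phi> n \<in> test_functions \<Omega>" "L2_tendsto \<Omega> \<phi> u"
      "L2_tendsto \<Omega> (\<lambda>n. curl (\<phi> n)) (weak_curl \<Omega> u)"
    using assms(3) by (auto simp: H0_curl_def)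
  have u: "u \<in> L2 \<Omega>" "weak_curl \<Omega> u \<in> L2 \<Omega>"
    using H0_curl_weak_curl[OF assms(3)] by (auto simp: has_weak_curl_def)
  have v: "v \<in> L2 \<Omega>" "w \<in> L2 \<Omega>"
    using assms(4) by (auto simp: has_weak_curl_def)
  note L2I = continuous_imp_L2[OF assms(1,2)]
  have "(\<lambda>n. L2_inner \<Omega> (curl (\<phi> n)) v) \<longlonglongrightarrow> L2_inner \<Omega> (weak_curl \<Omega> u) v"
    by (rule L2_inner_tendsto_left[OF \<phi>(3) L2I[OF curl_test_function_continuous[OF \<phi>(1)]] u(2) v(1)])
  moreover have "(\<lambda>n. L2_inner \<Omega> (\<phi> n) w) \<longlonglongrightarrow> L2_inner \<Omega> u w"
    by (rule L2_inner_tendsto_left[OF \<phi>(2) L2I[OF test_function_continuous[OF \<phi>(1)]] u(1) v(2)])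
  moreover have "L2_inner \<Omega> (curl (\<phi> n)) v = L2_inner \<Omega> (\<phi> n) w" for n
    using assms(4) \<phi>(1)[of n]
    by (auto simp: has_weak_curl_def L2_inner_commute[of \<Omega> "\<phi> n" w]
          L2_inner_commute[of \<Omega> "curl (\<phi> n)" v])
  ultimately show ?thesis by (simp add: LIMSEQ_unique)
qed

lemma has_weak_div_add:
  assumes "open \<Omega>" "bounded \<Omega>" "has_weak_div \<Omega> u p" "has_weak_div \<Omega> v q"
  shows "has_weak_div \<Omega> (\<lambda>x. u x + v x) (\<lambda>x. p x + q x)"
  using assms
  by (auto simp: has_weak_div_def L2_add L2_inner_add_left
      continuous_imp_L2 grad_test_function_continuous test_function_continuous)

lemma has_weak_div_scaleR:
  assumes "has_weak_div \<Omega> u p"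
  shows "has_weak_div \<Omega> (\<lambda>x. c *\<^sub>R u x) (\<lambda>x. c *\<^sub>R p x)"
  using assms by (simp add: has_weak_div_def L2_scaleR L2_inner_scaleR_left del: real_scaleR_def)

lemma has_weak_div_cong_AE:
  assumes "open \<Omega>" "bounded \<Omega>" "has_weak_div \<Omega> u p"
    and "ae_eq \<Omega> u u'" "u' \<in> L2 \<Omega>" and "ae_eq \<Omega> p p'" "p' \<in> L2 \<Omega>"
  shows "has_weak_div \<Omega> u' p'"
  unfolding has_weak_div_def
proof (intro conjI ballI)
  fix \<psi> :: "r3 \<Rightarrow> real" assume \<psi>: "\<psi> \<in> test_functions \<Omega>"
  have "\<psi> \<in> L2 \<Omega>" "grad \<psi> \<in> L2 \<Omega>"
    using \<psi> assms(1,2)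
    by (auto intro: continuous_imp_L2 grad_test_function_continuous test_function_continuous)
  then show "L2_inner \<Omega> p' \<psi> = - L2_inner \<Omega> u' (grad \<psi>)"
    using \<psi> assms L2_inner_cong_AE[of \<Omega> u u' "grad \<psi>"] L2_inner_cong_AE[of \<Omega> p p' \<psi>]
    by (auto simp: has_weak_div_def)
qed (use assms in auto)

section \<open>Finite element spaces\<close>

lemma ae_eq_refl: "ae_eq \<Omega> f f"
  by (simp add: ae_eq_def)

lemma fe_space_add:
  assumes "fe_space \<Omega> V" "v \<in> V" "w \<in> V"
  shows "(\<lambda>x. v x + w x) \<in> V"
proof -
  obtain b where V: "V = {v. \<exists>c. ae_eq \<Omega> v (\<lambda>x. \<Sum>f\<in>b. c f *\<^sub>R f x)}"
    using assms(1) by (auto simp: fe_space_def)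
  obtain c d where "ae_eq \<Omega> v (\<lambda>x. \<Sum>f\<in>b. c f *\<^sub>R f x)" "ae_eq \<Omega> w (\<lambda>x. \<Sum>f\<in>b. d f *\<^sub>R f x)"
    using assms V by auto
  then have "ae_eq \<Omega> (\<lambda>x. v x + w x) (\<lambda>x. \<Sum>f\<in>b. (c f + d f) *\<^sub>R f x)"
    unfolding ae_eq_def by eventually_elim (simp add: scaleR_add_left sum.distrib)
  then show ?thesis
    unfolding V by (intro CollectI exI[of _ "\<lambda>f. c f + d f"])
qed

lemma fe_space_scaleR:
  assumes "fe_space \<Omega> V" "v \<in> V"
  shows "(\<lambda>x. r *\<^sub>R v x) \<in> V"
proof -
  obtain b where V: "V = {v. \<exists>c. ae_eq \<Omega> v (\<lambda>x. \<Sum>f\<in>b. c f *\<^sub>R f x)}"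
    using assms(1) by (auto simp: fe_space_def)
  obtain c where "ae_eq \<Omega> v (\<lambda>x. \<Sum>f\<in>b. c f *\<^sub>R f x)"
    using assms V by auto
  then have "ae_eq \<Omega> (\<lambda>x. r *\<^sub>R v x) (\<lambda>x. \<Sum>f\<in>b. (r * c f) *\<^sub>R f x)"
    unfolding ae_eq_def by eventually_elim (simp add: scaleR_sum_right)
  then show ?thesis
    unfolding V by (intro CollectI exI[of _ "\<lambda>f. r * c f"])
qed

lemma midpt_mem:
  assumes "fe_space \<Omega> V" "\<And>k. u k \<in> V"
  shows "midpt u k \<in> V"
  using fe_space_scaleR[OF assms(1) fe_space_add[OF assms(1) assms(2) assms(2)], of "1/2" "Suc k" k]
  by (simp add: midpt_def[abs_def])

lemma diff_quot_mem:
  assumes "fe_space \<Omega> V" "\<And>k. u k \<in> V"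
  shows "diff_quot dt u k \<in> V"
proof -
  have "diff_quot dt u k = (\<lambda>x. inverse dt *\<^sub>R (u (Suc k) x + (-1) *\<^sub>R u k x))"
    by (simp add: diff_quot_def[abs_def])
  then show ?thesis
    using fe_space_scaleR[OF assms(1) fe_space_add[OF assms(1) assms(2) fe_space_scaleR[OF assms]]]
    by metis
qed

text \<open>The Hall current \<open>r j \<times> H\<close> is orthogonal to \<open>j\<close> and so does no work; the induction term is turned
  into the work of the Lorentz force by cyclic permutation of the triple product.\<close>

lemma Hall_term_work: "cross3 (r *\<^sub>R j - U) H \<bullet> j = cross3 j H \<bullet> (U :: r3)"
  by (simp add: cross3_def inner_vec_def sum_3 algebra_simps vector_3)

section \<open>The time step\<close>

text \<open>The reason for the midpoint rule: the difference of the squares factors as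
  \<open>(u' - u) \<bullet> (u' + u)\<close>.\<close>

lemma energy_increment:
  assumes "u k \<in> L2 \<Omega>" "u (Suc k) \<in> L2 \<Omega>" "dt \<noteq> 0"
  shows "L2_inner \<Omega> (u (Suc k)) (u (Suc k)) - L2_inner \<Omega> (u k) (u k)
           = 2 * dt * L2_inner \<Omega> (diff_quot dt u k) (midpt u k)"
proof -
  have "((a - b) /\<^sub>R dt) \<bullet> ((1/2) *\<^sub>R (a + b)) = (1 / (2 * dt)) * (a \<bullet> a - b \<bullet> b)" for a b :: r3
  proof -
    have "(a - b) \<bullet> (a + b) = a \<bullet> a - b \<bullet> b"
      by (simp add: inner_add_right inner_diff_left inner_commute[of b a])
    then show ?thesis
      by (simp add: inverse_eq_divide)
  qed
  then have "L2_inner \<Omega> (diff_quot dt u k) (midpt u k)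
      = (LINT x|lebesgue_on \<Omega>. (1 / (2 * dt)) * (u (Suc k) x \<bullet> u (Suc k) x - u k x \<bullet> u k x))"
    by (simp only: L2_inner_def diff_quot_def midpt_def)
  then show ?thesis
    using assms by (simp add: L2_inner_def integrable_L2_inner)
qed

locale ideal_hall_mhd_solution =
  fixes \<Omega> :: "r3 set" and Vgrad Q :: "(r3 \<Rightarrow> real) set" and Vcurl Vdiv :: "(r3 \<Rightarrow> r3) set"
    and S RH dt :: real and u B E j H \<omega> U \<alpha> :: "nat \<Rightarrow> r3 \<Rightarrow> r3" and p :: "nat \<Rightarrow> r3 \<Rightarrow> real"
  assumes open_domain: "open \<Omega>" and bounded_domain: "bounded \<Omega>"
    and step_nonzero: "dt \<noteq> 0"
    and complex: "discrete_de_Rham \<Omega> Vgrad Vcurl Vdiv Q"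
    and scheme: "ideal_hall_mhd_scheme \<Omega> Vcurl Vdiv Q S RH dt u B p E j H \<omega> U \<alpha>"
begin

lemma Vcurl_weak_curl: "v \<in> Vcurl \<Longrightarrow> has_weak_curl \<Omega> v (weak_curl \<Omega> v)"
  using complex by (auto simp: discrete_de_Rham_def intro: H0_curl_weak_curl)

lemma Vdiv_weak_div: "v \<in> Vdiv \<Longrightarrow> has_weak_div \<Omega> v (weak_div \<Omega> v)"
  using complex by (auto simp: discrete_de_Rham_def intro: H0_div_weak_div)

lemma Vcurl_L2: "v \<in> Vcurl \<Longrightarrow> v \<in> L2 \<Omega>"
  using Vcurl_weak_curl by (auto simp: has_weak_curl_def)

lemma Vdiv_L2: "v \<in> Vdiv \<Longrightarrow> v \<in> L2 \<Omega>"
  using Vdiv_weak_div by (auto simp: has_weak_div_def)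

text \<open>Exactness at \<open>Vdiv\<close>, in the direction saying that discrete curls are admissible and divergence
  free.\<close>

lemma curl_in_Vdiv:
  assumes "v \<in> Vcurl"
  shows "weak_curl \<Omega> v \<in> Vdiv" "has_weak_div \<Omega> (weak_curl \<Omega> v) (\<lambda>_. 0)"
proof -
  have "weak_curl \<Omega> v \<in> {w \<in> Vdiv. has_weak_div \<Omega> w (\<lambda>_. 0)}"
    using complex Vcurl_weak_curl[OF assms] assms unfolding discrete_de_Rham_def by blast
  then show "weak_curl \<Omega> v \<in> Vdiv" "has_weak_div \<Omega> (weak_curl \<Omega> v) (\<lambda>_. 0)"
    by auto
qed

lemma div_in_Q: "v \<in> Vdiv \<Longrightarrow> weak_div \<Omega> v \<in> Q"
  using complex Vdiv_weak_div[of v] unfolding discrete_de_Rham_def by blast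

lemma fe_Vdiv: "fe_space \<Omega> Vdiv"
  using complex by (simp add: discrete_de_Rham_def)

lemma solution_mem:
  "u k \<in> Vdiv" "B k \<in> Vdiv" "p k \<in> Q" "E k \<in> Vcurl" "j k \<in> Vcurl" "H k \<in> Vcurl" "U k \<in> Vcurl"
  "\<alpha> k \<in> Vcurl"
  using scheme by (auto simp: ideal_hall_mhd_scheme_def)

lemma midpt_Vdiv: "midpt u k \<in> Vdiv" "midpt B k \<in> Vdiv"
  using fe_Vdiv solution_mem by (auto intro: midpt_mem)

lemma momentum:
  "v \<in> Vdiv \<Longrightarrow> L2_inner \<Omega> (diff_quot dt u k) v + L2_inner \<Omega> (\<alpha> k) v
     + L2_inner \<Omega> (weak_div \<Omega> v) (p k) = 0"
  and incompressibility: "q \<in> Q \<Longrightarrow> L2_inner \<Omega> (weak_div \<Omega> (midpt u k)) q = 0"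
  and faraday: "C \<in> Vdiv \<Longrightarrow>
     L2_inner \<Omega> (diff_quot dt B k) C + L2_inner \<Omega> (weak_curl \<Omega> (E k)) C = 0"
  and ampere: "F \<in> Vcurl \<Longrightarrow> L2_inner \<Omega> (j k) F = L2_inner \<Omega> (midpt B k) (weak_curl \<Omega> F)"
  and H_projection: "G \<in> Vcurl \<Longrightarrow> L2_inner \<Omega> (H k) G = L2_inner \<Omega> (midpt B k) G"
  and U_projection: "G \<in> Vcurl \<Longrightarrow> L2_inner \<Omega> (U k) G = L2_inner \<Omega> (midpt u k) G"
  and alpha_projection: "G \<in> Vcurl \<Longrightarrow>
     L2_inner \<Omega> (\<alpha> k) G = L2_inner \<Omega> (\<lambda>x. cross3 (\<omega> k x) (U k x)) G
                      - S * L2_inner \<Omega> (\<lambda>x. cross3 (j k x) (H k x)) G"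
  and ohm: "G \<in> Vcurl \<Longrightarrow>
     L2_inner \<Omega> (E k) G = L2_inner \<Omega> (\<lambda>x. cross3 (RH *\<^sub>R j k x - U k x) (H k x)) G"
  using scheme by (auto simp: ideal_hall_mhd_scheme_def algebra_simps)

text \<open>The equations control only the midpoint \<open>(u' + u) / 2\<close>, so the new velocity is recovered as
  twice the midpoint minus the old velocity.\<close>

lemma velocity_divergence_free:
  assumes "has_weak_div \<Omega> (u 0) (\<lambda>_. 0)"
  shows "has_weak_div \<Omega> (u k) (\<lambda>_. 0)"
proof (induction k)
  case (Suc k)
  let ?d = "weak_div \<Omega> (midpt u k)"
  have d: "has_weak_div \<Omega> (midpt u k) ?d"
    by (rule Vdiv_weak_div[OF midpt_Vdiv(1)])
  then have dL2: "?d \<in> L2 \<Omega>" by (simp add: has_weak_div_def)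
  have "L2_inner \<Omega> ?d ?d = 0"
    by (intro incompressibility div_in_Q midpt_Vdiv)
  then have "ae_eq \<Omega> ?d (\<lambda>_. 0)"
    by (rule L2_inner_self_eq_zero_imp[OF dL2])
  then have "has_weak_div \<Omega> (midpt u k) (\<lambda>_. 0)"
    using has_weak_div_cong_AE[OF open_domain bounded_domain d ae_eq_refl _ _ L2_zero]
      Vdiv_L2[OF midpt_Vdiv(1)] by blast
  from has_weak_div_add[OF open_domain bounded_domain
      has_weak_div_scaleR[OF this, of 2] has_weak_div_scaleR[OF Suc, of "-1"]]
  show ?case by (simp add: midpt_def)
qed (rule assms)

text \<open>Both terms of Faraday's law lie in \<open>Vdiv\<close>, so their sum is an admissible test function for itself.\<close>

lemma faraday_AE:
  "ae_eq \<Omega> (\<lambda>x. B k x + (- dt) *\<^sub>R weak_curl \<Omega> (E k) x) (B (Suc k))"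
proof -
  let ?r = "\<lambda>x. diff_quot dt B k x + weak_curl \<Omega> (E k) x"
  have d: "diff_quot dt B k \<in> Vdiv" and c: "weak_curl \<Omega> (E k) \<in> Vdiv"
    using solution_mem curl_in_Vdiv fe_Vdiv by (auto intro: diff_quot_mem)
  have r: "?r \<in> Vdiv" using fe_space_add[OF fe_Vdiv d c] .
  have "L2_inner \<Omega> ?r ?r = 0"
    using faraday[OF r, of k] by (simp only: L2_inner_add_left[OF Vdiv_L2 Vdiv_L2 Vdiv_L2, OF d c r])
  then have "ae_eq \<Omega> ?r (\<lambda>_. 0)"
    by (rule L2_inner_self_eq_zero_imp[OF Vdiv_L2[OF r]])
  then show ?thesis
    unfolding ae_eq_def
  proof eventually_elim
    case (elim x)
    have "B (Suc k) x - B k x = dt *\<^sub>R diff_quot dt B k x"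
      using step_nonzero by (simp add: diff_quot_def)
    also have "diff_quot dt B k x = - weak_curl \<Omega> (E k) x"
      using elim by (simp add: eq_neg_iff_add_eq_0)
    finally show ?case by (simp add: algebra_simps)
  qed
qed

lemma magnetic_divergence_free:
  assumes "has_weak_div \<Omega> (B 0) (\<lambda>_. 0)"
  shows "has_weak_div \<Omega> (B k) (\<lambda>_. 0)"
proof (induction k)
  case (Suc k)
  have "has_weak_div \<Omega> (\<lambda>x. B k x + (- dt) *\<^sub>R weak_curl \<Omega> (E k) x) (\<lambda>_. 0)"
    using has_weak_div_add[OF open_domain bounded_domain Suc
        has_weak_div_scaleR[OF curl_in_Vdiv(2)[OF solution_mem(4)], of "- dt"]] by simp
  then show ?case
    using has_weak_div_cong_AE[OF open_domain bounded_domain _ faraday_AE _ ae_eq_refl L2_zero]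
      Vdiv_L2[OF solution_mem(2)] by blast
qed (rule assms)

text \<open>The momentum equation sees the Lorentz force through \<open>\<alpha>\<close> tested with \<open>U\<close>; the induction equation
  sees it through Ohm's law tested with \<open>j\<close>, since \<open>(curl E, B) = (E, j)\<close> at the midpoint. What the
  magnetic field loses is thus what the velocity gains, up to the factor \<open>S\<close>.\<close>

lemma Lorentz_work_cancels:
  "L2_inner \<Omega> (diff_quot dt u k) (midpt u k) = S * L2_inner \<Omega> (\<lambda>x. cross3 (j k x) (H k x)) (U k)"
  "L2_inner \<Omega> (diff_quot dt B k) (midpt B k) = - L2_inner \<Omega> (\<lambda>x. cross3 (j k x) (H k x)) (U k)"
proof -
  have "L2_inner \<Omega> (\<lambda>x. cross3 (\<omega> k x) (U k x)) (U k) = 0"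
    by (simp add: L2_inner_def dot_cross_self)
  moreover have "L2_inner \<Omega> (\<alpha> k) (midpt u k) = L2_inner \<Omega> (\<alpha> k) (U k)"
    using U_projection[OF solution_mem(8)] by (simp add: L2_inner_commute[of \<Omega> "\<alpha> k"])
  moreover have "L2_inner \<Omega> (weak_div \<Omega> (midpt u k)) (p k) = 0"
    by (rule incompressibility[OF solution_mem(3)])
  ultimately show "L2_inner \<Omega> (diff_quot dt u k) (midpt u k)
      = S * L2_inner \<Omega> (\<lambda>x. cross3 (j k x) (H k x)) (U k)"
    using momentum[OF midpt_Vdiv(1), of k k] alpha_projection[OF solution_mem(7), of k k] by simp
  have "L2_inner \<Omega> (weak_curl \<Omega> (E k)) (midpt B k) = L2_inner \<Omega> (E k) (j k)"
    using ampere[OF solution_mem(4)] by (metis L2_inner_commute)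
  also have "\<dots> = L2_inner \<Omega> (\<lambda>x. cross3 (j k x) (H k x)) (U k)"
    unfolding ohm[OF solution_mem(5)] by (simp add: L2_inner_def Hall_term_work)
  finally show "L2_inner \<Omega> (diff_quot dt B k) (midpt B k)
      = - L2_inner \<Omega> (\<lambda>x. cross3 (j k x) (H k x)) (U k)"
    using faraday[OF midpt_Vdiv(2), of k k] by simp
qed

lemma energy_conservation:
  "(LINT x|lebesgue_on \<Omega>. u (Suc k) x \<bullet> u (Suc k) x + S * (B (Suc k) x \<bullet> B (Suc k) x))
     = (LINT x|lebesgue_on \<Omega>. u k x \<bullet> u k x + S * (B k x \<bullet> B k x))"
proof -
  have L2: "u n \<in> L2 \<Omega>" "B n \<in> L2 \<Omega>" for n
    by (intro Vdiv_L2 solution_mem)+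
  have split: "(LINT x|lebesgue_on \<Omega>. u n x \<bullet> u n x + S * (B n x \<bullet> B n x))
      = L2_inner \<Omega> (u n) (u n) + S * L2_inner \<Omega> (B n) (B n)" for n
    by (simp add: L2_inner_def integrable_L2_inner L2)
  have "L2_inner \<Omega> (u (Suc k)) (u (Suc k)) - L2_inner \<Omega> (u k) (u k)
      + S * (L2_inner \<Omega> (B (Suc k)) (B (Suc k)) - L2_inner \<Omega> (B k) (B k)) = 0"
    by (simp add: energy_increment[of u, OF L2(1) L2(1) step_nonzero]
        energy_increment[of B, OF L2(2) L2(2) step_nonzero] Lorentz_work_cancels)
  then show ?thesis by (simp add: split algebra_simps)
qed

text \<open>The discrete form of \<open>E \<bullet> B = 0\<close> for an ideal fluid. It need not hold pointwise for the midpoint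
  field; the projection \<open>H\<close> in Ohm's law is there to make the integral vanish.\<close>

lemma electric_field_orthogonal: "L2_inner \<Omega> (midpt B k) (E k) = 0"
proof -
  have "L2_inner \<Omega> (midpt B k) (E k) = L2_inner \<Omega> (E k) (H k)"
    using H_projection[OF solution_mem(4)] by (simp add: L2_inner_commute)
  also have "\<dots> = 0"
    unfolding ohm[OF solution_mem(6)] by (simp add: L2_inner_def dot_cross_self)
  finally show ?thesis .
qed

text \<open>The helicity changes by \<open>(A' + A, B' - B)\<close>, because the mixed terms \<open>(A', B)\<close> and \<open>(A, B')\<close>
  agree by symmetry of the curl. This pairing is \<open>- dt (B' + B, E)\<close>, a multiple of the vanishing
  pairing of the midpoint field with \<open>E\<close>.\<close>

lemma helicity_conservation:
  assumes "\<And>k. A k \<in> Vcurl \<and> ae_eq \<Omega> (weak_curl \<Omega> (A k)) (B k)"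
  shows "(LINT x|lebesgue_on \<Omega>. A (Suc k) x \<bullet> B (Suc k) x) = (LINT x|lebesgue_on \<Omega>. A k x \<bullet> B k x)"
proof -
  have A: "A n \<in> L2 \<Omega>" and B: "B n \<in> L2 \<Omega>" for n
    using assms by (auto intro: Vcurl_L2 Vdiv_L2 solution_mem)
  have cE: "weak_curl \<Omega> (E k) \<in> L2 \<Omega>"
    by (intro Vdiv_L2 curl_in_Vdiv solution_mem)
  have by_parts: "L2_inner \<Omega> (A n) (weak_curl \<Omega> v) = L2_inner \<Omega> (B n) v" if v: "v \<in> Vcurl" for n v
  proof -
    have An: "A n \<in> Vcurl" "A n \<in> H0_curl \<Omega>"
      using assms complex by (auto simp: discrete_de_Rham_def)
    have "L2_inner \<Omega> (A n) (weak_curl \<Omega> v) = L2_inner \<Omega> (weak_curl \<Omega> (A n)) v"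
      using weak_curl_symmetric[OF open_domain bounded_domain An(2) Vcurl_weak_curl[OF v]] by simp
    also have "\<dots> = L2_inner \<Omega> (B n) v"
      using L2_inner_cong_AE[OF _ Vdiv_L2[OF curl_in_Vdiv(1)[OF An(1)]] B Vcurl_L2[OF v]] assms by blast
    finally show ?thesis .
  qed
  have curlA: "L2_inner \<Omega> (A m) (weak_curl \<Omega> (A n)) = L2_inner \<Omega> (A m) (B n)" for m n
    using L2_inner_cong_AE[of \<Omega> "weak_curl \<Omega> (A n)" "B n" "A m"] assms A B
      Vdiv_L2[OF curl_in_Vdiv(1)] by (metis L2_inner_commute)
  have symm: "L2_inner \<Omega> (A m) (B n) = L2_inner \<Omega> (A n) (B m)" for m n
    using by_parts[of "A n" m] curlA[of m n] assms by (simp add: L2_inner_commute)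
  have step: "L2_inner \<Omega> (A n) (B (Suc k)) = L2_inner \<Omega> (A n) (B k) - dt * L2_inner \<Omega> (B n) (E k)" for n
  proof -
    have "L2_inner \<Omega> (B (Suc k)) (A n) = L2_inner \<Omega> (\<lambda>x. B k x + (- dt) *\<^sub>R weak_curl \<Omega> (E k) x) (A n)"
      using L2_inner_cong_AE[OF faraday_AE L2_add[OF B L2_scaleR[OF cE]] B A] by simp
    also have "\<dots> = L2_inner \<Omega> (B k) (A n) - dt * L2_inner \<Omega> (weak_curl \<Omega> (E k)) (A n)"
      by (simp only: L2_inner_add_left[OF B L2_scaleR[OF cE] A] L2_inner_scaleR_left)
    finally show ?thesis
      using by_parts[OF solution_mem(4), of n k] by (simp add: L2_inner_commute)
  qed
  have "L2_inner \<Omega> (midpt B k) (E k) = (1/2) * (L2_inner \<Omega> (B (Suc k)) (E k) + L2_inner \<Omega> (B k) (E k))"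
    unfolding midpt_def[abs_def] L2_inner_scaleR_left
    by (simp only: L2_inner_add_left[OF B B Vcurl_L2[OF solution_mem(4)]])
  then have "L2_inner \<Omega> (B (Suc k)) (E k) = - L2_inner \<Omega> (B k) (E k)"
    using electric_field_orthogonal[of k] by simp
  then have "L2_inner \<Omega> (A (Suc k)) (B (Suc k)) = L2_inner \<Omega> (A k) (B k)"
    using step[of "Suc k"] step[of k] symm[of "Suc k" k] by simp
  then show ?thesis by (simp add: L2_inner_def)
qed

end

theorem theorem13:
  fixes \<Omega> :: "(real^3) set"
    and Vgrad Q :: "(real^3 \<Rightarrow> real) set"
    and Vcurl Vdiv :: "(real^3 \<Rightarrow> real^3) set"
    and S RH \<Delta>t :: real
    and u B E j H \<omega> U \<alpha> A :: "nat \<Rightarrow> real^3 \<Rightarrow> real^3"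
    and p :: "nat \<Rightarrow> real^3 \<Rightarrow> real"
  assumes "lipschitz_polyhedron \<Omega>" and "simply_connected \<Omega>"
    and "S > 0" and "RH \<ge> 0" and "\<Delta>t > 0"
    and "discrete_de_Rham \<Omega> Vgrad Vcurl Vdiv Q"
    and "ideal_hall_mhd_scheme \<Omega> Vcurl Vdiv Q S RH \<Delta>t u B p E j H \<omega> U \<alpha>"
    and "has_weak_div \<Omega> (u 0) (\<lambda>_. 0)" and "has_weak_div \<Omega> (B 0) (\<lambda>_. 0)"
    and "\<And>k. A k \<in> Vcurl \<and> ae_eq \<Omega> (weak_curl \<Omega> (A k)) (B k)"
  shows "\<forall>k.
      (LINT x|lebesgue_on \<Omega>. u (Suc k) x \<bullet> u (Suc k) x + S * (B (Suc k) x \<bullet> B (Suc k) x))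
        = (LINT x|lebesgue_on \<Omega>. u k x \<bullet> u k x + S * (B k x \<bullet> B k x)) \<and>
      (LINT x|lebesgue_on \<Omega>. A (Suc k) x \<bullet> B (Suc k) x) = (LINT x|lebesgue_on \<Omega>. A k x \<bullet> B k x) \<and>
      has_weak_div \<Omega> (u k) (\<lambda>_. 0) \<and> has_weak_div \<Omega> (B k) (\<lambda>_. 0)"
proof -
  interpret ideal_hall_mhd_solution \<Omega> Vgrad Q Vcurl Vdiv S RH \<Delta>t u B E j H \<omega> U \<alpha> p
    using assms(1,5-7) by unfold_locales (auto simp: lipschitz_polyhedron_def)
  show ?thesis
    using energy_conservation helicity_conservation[of A, OF assms(10)]
      velocity_divergence_free[OF assms(8)] magnetic_divergence_free[OF assms(9)] by blast
qed

end
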